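(* Let $n\ge 1$, let $f_1$ be a polynomial of degree at most $n$, strictly increasing on $[a,b]$ ($a<b$), with coordinates given by $f_1(x)=\sum_{k=0}^n\gamma_{n,k}p_{n,k}(x)$. Then the following are equivalent: a) There exists a generalized Bernstein operator $B_n^{f_1}:C[a,b]\to\mathbb{P}_n[a,b]$ fixing $\mathbf{1}$ and $f_1$, and defined by $B_n^{f_1}f(x)=\sum_{k=0}^n f(t_{n,k})\,p_{n,k}(x)$, where $a=t_{n,0}\le\dots\le t_{n,n}=b$ (resp. $a=t_{n,0}<\dots<t_{n,n}=b$). b) The coefficients $\gamma_{n,k}$, $k=0,\dots,n$, are non-decreasing in $k$ (resp. strictly increasing in $k$). c) The coefficients $w_k$, $k=0,\dots,n-1$, defined by $\frac{d}{dx}f_1=\sum_{k=0}^{n-1}w_kp_{n-1,k}$, are non-negative (resp. strictly positive). (That is, the three non-strict conditions are equivalent to each other, and the three "resp." conditions are equivalent to each other.)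
   Context: $\mathbb{P}_n[a,b]$ is the space of real polynomials of degree at most $n$ on $[a,b]$, with the standard Bernstein basis $p_{n,k}(x)=\binom{n}{k}\frac{(x-a)^k(b-x)^{n-k}}{(b-a)^n}$, $k=0,\dots,n$. A generalized Bernstein operator $B_n:C[a,b]\to\mathbb{P}_n[a,b]$ is an operator of the form $B_nf=\sum_{k=0}^n f(t_{n,k})\,\alpha_{n,k}\,p_{n,k}$ with nodes $t_{n,0},\dots,t_{n,n}\in[a,b]$ and weights $\alpha_{n,k}>0$. It fixes $g$ if $B_ng=g$; $\mathbf{1}$ is the constant function $1$. *)

theory Defs
  imports "HOL-Analysis.Analysis" "HOL-Computational_Algebra.Polynomial"
begin

text \<open>Functions on the interval from \<open>a\<close> to \<open>b\<close> are represented by total functions on the reals of which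
  only the values on \<^term>\<open>{a..b}\<close> matter; accordingly all equations between functions below are
  required on \<^term>\<open>{a..b}\<close> only.\<close>

definition poly_space :: "nat \<Rightarrow> real \<Rightarrow> real \<Rightarrow> (real \<Rightarrow> real) set" where
  "poly_space n a b =
     {f. \<exists>p :: real poly. degree p \<le> n \<and> (\<forall>x\<in>{a..b}. f x = poly p x)}"

text \<open>For \<open>a = 0\<close> and \<open>b = 1\<close> this is the library's \<^const>\<open>Bernstein\<close>.\<close>

definition bernstein_basis :: "nat \<Rightarrow> real \<Rightarrow> real \<Rightarrow> nat \<Rightarrow> real \<Rightarrow> real" where
  "bernstein_basis n a b k x =
     real (n choose k) * ((x - a) ^ k * (b - x) ^ (n - k) / (b - a) ^ n)"

text \<open>\<open>B\<close> is the generalized Bernstein operator with nodes \<open>t 0, \<dots>, t n\<close> and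
  weights \<open>\<alpha> 0, \<dots>, \<alpha> n\<close>. Its domain is the set of functions continuous on \<^term>\<open>{a..b}\<close>;
  nothing is said about \<open>B f\<close> for other \<open>f\<close>.\<close>

definition gen_bernstein_operator ::
  "nat \<Rightarrow> real \<Rightarrow> real \<Rightarrow> (nat \<Rightarrow> real) \<Rightarrow> (nat \<Rightarrow> real)
     \<Rightarrow> ((real \<Rightarrow> real) \<Rightarrow> (real \<Rightarrow> real)) \<Rightarrow> bool" where
  "gen_bernstein_operator n a b t \<alpha> B \<longleftrightarrow>
     (\<forall>k\<le>n. t k \<in> {a..b}) \<and> (\<forall>k\<le>n. \<alpha> k > 0) \<and>
     (\<forall>f. continuous_on {a..b} f \<longrightarrow>
        B f \<in> poly_space n a b \<and>
        (\<forall>x\<in>{a..b}. B f x = (\<Sum>k\<le>n. f (t k) * \<alpha> k * bernstein_basis n a b k x)))"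

definition op_fixes ::
  "real \<Rightarrow> real \<Rightarrow> ((real \<Rightarrow> real) \<Rightarrow> (real \<Rightarrow> real)) \<Rightarrow> (real \<Rightarrow> real) \<Rightarrow> bool" where
  "op_fixes a b B g \<longleftrightarrow> (\<forall>x\<in>{a..b}. B g x = g x)"

end

theory Submission
  imports Defs
begin

text \<open>
  Everything rests on the linear independence of the Bernstein basis on \<open>[a, b]\<close>
  (\<open>bernstein_sum_eq_imp_coeff_eq\<close>), which permits comparing coefficients.

  Fixing \<open>\<one>\<close> is the partition of unity. Fixing \<open>f1\<close> means
  \<open>\<Sum>k. f1 (t k) * p k = \<Sum>k. \<gamma> k * p k\<close>, i.e. \<open>f1 (t k) = \<gamma> k\<close> for all \<open>k \<le> n\<close>. Since \<open>f1\<close> is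
  strictly increasing, the nodes are then ordered exactly as the coefficients are, both strictly
  and non-strictly. Conversely, \<open>\<gamma> 0 = f1 a\<close> and \<open>\<gamma> n = f1 b\<close>, so a non-decreasing \<open>\<gamma>\<close> takes its
  values in \<open>[f1 a, f1 b]\<close>, and the intermediate value theorem provides the nodes.

  Finally the derivative of \<open>\<Sum>k. \<gamma> k * p k\<close> has the coefficients \<open>n / (b - a) * (\<gamma> (k + 1) - \<gamma> k)\<close>
  in the basis of degree \<open>n - 1\<close>, so these are the \<open>w k\<close>, and their signs are those of the
  increments of \<open>\<gamma>\<close>.
\<close>

section \<open>The Bernstein basis on an interval\<close>

lemma bernstein_basis_left:
  assumes "a < b"
  shows "bernstein_basis n a b k a = (if k = 0 then 1 else 0)"
  using assms by (simp add: bernstein_basis_def)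

lemma bernstein_basis_right:
  assumes "a < b" "k \<le> n"
  shows "bernstein_basis n a b k b = (if k = n then 1 else 0)"
  using assms by (simp add: bernstein_basis_def)

lemma bernstein_sum_left:
  assumes "a < b"
  shows "(\<Sum>k\<le>n. c k * bernstein_basis n a b k a) = c 0"
  using assms by (simp add: bernstein_basis_left sum.delta if_distrib cong: if_cong)

lemma bernstein_sum_right:
  assumes "a < b"
  shows "(\<Sum>k\<le>n. c k * bernstein_basis n a b k b) = c n"
proof -
  have "(\<Sum>k\<le>n. c k * bernstein_basis n a b k b) = (\<Sum>k\<le>n. if k = n then c k else 0)"
    using assms by (intro sum.cong) (auto simp: bernstein_basis_right)
  then show ?thesis by simp
qed

lemma bernstein_basis_partition_of_unity:
  assumes "a < b"
  shows "(\<Sum>k\<le>n. bernstein_basis n a b k x) = 1"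
proof -
  have "(\<Sum>k\<le>n. bernstein_basis n a b k x)
      = (\<Sum>k\<le>n. real (n choose k) * (x - a) ^ k * (b - x) ^ (n - k)) / (b - a) ^ n"
    by (simp add: bernstein_basis_def sum_divide_distrib mult.assoc)
  also have "\<dots> = ((x - a) + (b - x)) ^ n / (b - a) ^ n"
    by (simp only: binomial_ring)
  finally show ?thesis using assms by simp
qed

lemma bernstein_sum_in_poly_space:
  "(\<lambda>x. \<Sum>k\<le>n. c k * bernstein_basis n a b k x) \<in> poly_space n a b"
proof -
  define q :: "nat \<Rightarrow> real poly" where
    "q k = smult (c k * real (n choose k) / (b - a) ^ n) ([:- a, 1:] ^ k * [:b, - 1:] ^ (n - k))" for k
  have "degree (q k) \<le> n" if "k \<le> n" for k
  proof -
    have "degree (q k) \<le> degree ([:- a, 1:] ^ k * [:b, - 1:] ^ (n - k))"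
      unfolding q_def by (rule degree_smult_le)
    also have "\<dots> \<le> degree ([:- a, 1:] ^ k) + degree ([:b, - 1:] ^ (n - k))"
      by (rule degree_mult_le)
    also have "\<dots> \<le> k + (n - k)"
      by (intro add_mono order.trans[OF degree_power_le]) auto
    finally show ?thesis using that by simp
  qed
  then have "degree (\<Sum>k\<le>n. q k) \<le> n"
    by (intro degree_sum_le) auto
  moreover have "(\<Sum>k\<le>n. c k * bernstein_basis n a b k x) = poly (\<Sum>k\<le>n. q k) x" for x
    by (simp add: poly_sum q_def bernstein_basis_def poly_power mult_ac)
  ultimately show ?thesis unfolding poly_space_def by blast
qed

text \<open>
  Under \<open>y = (x - a) / (b - x)\<close>, which maps \<open>[a, b)\<close> onto \<open>[0, \<infinity>)\<close>, a linear combination of the basis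
  functions becomes a polynomial in \<open>y\<close> divided by \<open>(1 + y) ^ n\<close>. If it vanishes on \<open>[a, b]\<close>, that
  polynomial has infinitely many zeros.
\<close>

lemma bernstein_sum_eq_0_imp_coeff_eq_0:
  assumes "a < b"
    and zero: "\<And>x. x \<in> {a..b} \<Longrightarrow> (\<Sum>k\<le>n. c k * bernstein_basis n a b k x) = 0"
    and "k \<le> n"
  shows "c k = 0"
proof -
  have vanish: "(\<Sum>k\<le>n. (c k * real (n choose k)) * y ^ k) = 0" if "y \<ge> 0" for y
  proof -
    define x where "x = (a + b * y) / (1 + y)"
    have y: "1 + y > 0" using that by simp
    have xa: "x - a = (b - a) * y / (1 + y)" and bx: "b - x = (b - a) / (1 + y)"
      using y by (simp_all add: x_def field_simps)
    have "x - a \<ge> 0" "b - x \<ge> 0" unfolding xa bx using that assms(1) by auto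
    then have "x \<in> {a..b}" by simp
    have basis: "bernstein_basis n a b k x = real (n choose k) * y ^ k / (1 + y) ^ n" if "k \<le> n" for k
    proof -
      have "(b - a) ^ n = (b - a) ^ k * (b - a) ^ (n - k)" "(1 + y) ^ n = (1 + y) ^ k * (1 + y) ^ (n - k)"
        using that by (simp_all flip: power_add)
      then show ?thesis
        using assms(1) y unfolding bernstein_basis_def xa bx
        by (simp add: power_divide power_mult_distrib)
    qed
    have "(\<Sum>k\<le>n. (c k * real (n choose k)) * y ^ k) / (1 + y) ^ n
        = (\<Sum>k\<le>n. c k * bernstein_basis n a b k x)"
      by (simp add: basis sum_divide_distrib mult.assoc)
    also have "\<dots> = 0" by (rule zero[OF \<open>x \<in> {a..b}\<close>])
    finally show ?thesis using y by simp
  qed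
  have "infinite {0::real..}" by (rule infinite_Ici)
  then have "infinite {y. (\<Sum>k\<le>n. (c k * real (n choose k)) * y ^ k) = 0}"
    by (rule contrapos_nn) (erule finite_subset[rotated], auto simp: vanish)
  then have "c k * real (n choose k) = 0"
    using polyfun_finite_roots[of "\<lambda>k. c k * real (n choose k)" n] \<open>k \<le> n\<close> by blast
  then show ?thesis using \<open>k \<le> n\<close> by simp
qed

lemma bernstein_sum_eq_imp_coeff_eq:
  assumes "a < b"
    and eq: "\<And>x. x \<in> {a..b} \<Longrightarrow>
      (\<Sum>k\<le>n. c k * bernstein_basis n a b k x) = (\<Sum>k\<le>n. d k * bernstein_basis n a b k x)"
    and "k \<le> n"
  shows "c k = d k"
proof -
  have "c k - d k = 0"
    using assms(1) _ \<open>k \<le> n\<close>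
    by (rule bernstein_sum_eq_0_imp_coeff_eq_0) (simp add: eq left_diff_distrib sum_subtractf)
  then show ?thesis by simp
qed

section \<open>The derivative in the Bernstein basis\<close>

text \<open>The case distinction encodes the convention that the basis function of index \<open>-1\<close> is zero. At
  \<open>k = m + 1\<close> no such convention is needed: the definition yields zero there, as the binomial
  coefficient vanishes.\<close>

lemma bernstein_basis_has_real_derivative:
  assumes "a < b" "k \<le> Suc m"
  shows "(bernstein_basis (Suc m) a b k has_real_derivative
      real (Suc m) / (b - a) *
        ((if k = 0 then 0 else bernstein_basis m a b (k - 1) x) - bernstein_basis m a b k x))
      (at x within S)"
proof -
  have ba: "b - a \<noteq> 0" using assms by simp
  have DX: "((\<lambda>x. (x - a) ^ k) has_real_derivative real k * (x - a) ^ (k - 1)) (at x within S)"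
    by (auto intro!: derivative_eq_intros)
  have DY: "((\<lambda>x. (b - x) ^ (Suc m - k)) has_real_derivative
      - (real (Suc m - k) * (b - x) ^ (m - k))) (at x within S)"
    by (auto intro!: derivative_eq_intros)
  have D: "(bernstein_basis (Suc m) a b k has_real_derivative
      real (Suc m choose k) * ((real k * (x - a) ^ (k - 1) * (b - x) ^ (Suc m - k)
        - real (Suc m - k) * (x - a) ^ k * (b - x) ^ (m - k)) / (b - a) ^ Suc m)) (at x within S)"
    unfolding bernstein_basis_def[abs_def]
    by (rule DERIV_cong[OF DERIV_cmult[OF DERIV_cdivide[OF DERIV_mult[OF DX DY]]]]) (simp add: mult_ac)
  have up: "real (Suc m choose k) * real k = (if k = 0 then 0 else real (Suc m) * real (m choose (k - 1)))"
  proof (cases k)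
    case (Suc j)
    have "(Suc m choose k) * k = Suc m * (m choose j)"
      unfolding Suc by (rule Suc_times_binomial_eq[symmetric])
    then show ?thesis using Suc by (simp only: flip: of_nat_mult) simp
  qed simp
  have down: "real (Suc m choose k) * real (Suc m - k) = real (Suc m) * real (m choose k)"
    using binomial_absorb_comp[of "Suc m" k] by (simp flip: of_nat_mult add: mult.commute del: of_nat_Suc)
  have "real (Suc m choose k) * ((real k * (x - a) ^ (k - 1) * (b - x) ^ (Suc m - k)
        - real (Suc m - k) * (x - a) ^ k * (b - x) ^ (m - k)) / (b - a) ^ Suc m)
      = ((real (Suc m choose k) * real k) * ((x - a) ^ (k - 1) * (b - x) ^ (Suc m - k))
        - (real (Suc m choose k) * real (Suc m - k)) * ((x - a) ^ k * (b - x) ^ (m - k))) / (b - a) ^ Suc m"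
    by (simp add: algebra_simps)
  also have "\<dots> = real (Suc m) / (b - a) *
        ((if k = 0 then 0 else bernstein_basis m a b (k - 1) x) - bernstein_basis m a b k x)"
    unfolding up down using ba
    by (cases k) (simp_all add: bernstein_basis_def field_simps del: of_nat_Suc)
  finally show ?thesis using D by (simp only:)
qed

lemma bernstein_sum_has_real_derivative:
  assumes "a < b"
  shows "((\<lambda>x. \<Sum>k\<le>Suc m. c k * bernstein_basis (Suc m) a b k x) has_real_derivative
      (\<Sum>k\<le>m. real (Suc m) / (b - a) * (c (Suc k) - c k) * bernstein_basis m a b k x))
      (at x within S)"
proof -
  define P where "P k = bernstein_basis m a b k x" for k
  define r where "r = real (Suc m) / (b - a)"
  have last: "P (Suc m) = 0" by (simp add: P_def bernstein_basis_def)
  have "((\<lambda>x. \<Sum>k\<le>Suc m. c k * bernstein_basis (Suc m) a b k x) has_real_derivative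
      (\<Sum>k\<le>Suc m. c k * (r * ((if k = 0 then 0 else P (k - 1)) - P k)))) (at x within S)"
    unfolding P_def r_def
    by (intro DERIV_sum DERIV_cmult bernstein_basis_has_real_derivative assms) auto
  also have "(\<Sum>k\<le>Suc m. c k * (r * ((if k = 0 then 0 else P (k - 1)) - P k)))
      = r * ((\<Sum>k\<le>Suc m. c k * (if k = 0 then 0 else P (k - 1))) - (\<Sum>k\<le>Suc m. c k * P k))"
    by (simp only: sum_distrib_left right_diff_distrib mult.left_commute flip: sum_subtractf)
  also have "\<dots> = r * ((\<Sum>k\<le>m. c (Suc k) * P k) - (\<Sum>k\<le>m. c k * P k))"
    by (subst sum.atMost_Suc_shift) (simp add: last)
  also have "\<dots> = (\<Sum>k\<le>m. r * (c (Suc k) - c k) * P k)"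
    by (simp add: sum_distrib_left algebra_simps flip: sum_subtractf)
  finally show ?thesis unfolding P_def r_def .
qed

section \<open>Monotonicity of coefficients and of nodes\<close>

lemma transp_atMost_Suc_iff:
  assumes "transp R"
  shows "(\<forall>i j. i < j \<longrightarrow> j \<le> Suc m \<longrightarrow> R (f i) (f j)) \<longleftrightarrow> (\<forall>k\<le>m. R (f k) (f (Suc k)))"
proof
  assume step: "\<forall>k\<le>m. R (f k) (f (Suc k))"
  have "R (f i) (f j)" if "i < j" "j \<le> Suc m" for i j
    using that
  proof (induction j)
    case (Suc j)
    then have "R (f j) (f (Suc j))" using step by simp
    with Suc show ?case using transpD[OF assms] by (cases "i = j") auto
  qed simp
  then show "\<forall>i j. i < j \<longrightarrow> j \<le> Suc m \<longrightarrow> R (f i) (f j)" by blast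
qed auto

lemma mono_on_atMost_Suc_iff:
  fixes f :: "nat \<Rightarrow> real"
  shows "mono_on {..Suc m} f \<longleftrightarrow> (\<forall>k\<le>m. f k \<le> f (Suc k))"
proof -
  have "mono_on {..Suc m} f \<longleftrightarrow> (\<forall>i j. i \<le> j \<longrightarrow> j \<le> Suc m \<longrightarrow> f i \<le> f j)"
    by (auto simp: mono_on_def)
  also have "\<dots> \<longleftrightarrow> (\<forall>i j. i < j \<longrightarrow> j \<le> Suc m \<longrightarrow> f i \<le> f j)"
    by (metis order_le_less order_refl)
  finally show ?thesis
    using transp_atMost_Suc_iff[of "(\<le>)" m f] by simp
qed

lemma strict_mono_on_atMost_Suc_iff:
  fixes f :: "nat \<Rightarrow> real"
  shows "strict_mono_on {..Suc m} f \<longleftrightarrow> (\<forall>k\<le>m. f k < f (Suc k))"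
proof -
  have "strict_mono_on {..Suc m} f \<longleftrightarrow> (\<forall>i j. i < j \<longrightarrow> j \<le> Suc m \<longrightarrow> f i < f j)"
    by (fastforce simp: strict_mono_on_def)
  then show ?thesis
    using transp_atMost_Suc_iff[of "(<)" m f] by simp
qed

lemma strict_mono_on_preimage_mono_iff:
  fixes f :: "real \<Rightarrow> real" and g t :: "nat \<Rightarrow> real"
  assumes f: "strict_mono_on S f"
    and t: "\<And>k. k \<le> n \<Longrightarrow> t k \<in> S" "\<And>k. k \<le> n \<Longrightarrow> f (t k) = g k"
  shows "mono_on {..n} t \<longleftrightarrow> mono_on {..n} g"
    and "strict_mono_on {..n} t \<longleftrightarrow> strict_mono_on {..n} g"
proof -
  have "t i \<le> t j \<longleftrightarrow> g i \<le> g j" "t i < t j \<longleftrightarrow> g i < g j" if "i \<le> n" "j \<le> n" for i j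
    using that t strict_mono_on_less_eq[OF f, of "t i" "t j"] strict_mono_on_less[OF f, of "t i" "t j"]
    by auto
  then show "mono_on {..n} t \<longleftrightarrow> mono_on {..n} g"
    and "strict_mono_on {..n} t \<longleftrightarrow> strict_mono_on {..n} g"
    by (simp_all add: mono_on_def strict_mono_on_def)
qed

section \<open>Generalized Bernstein operators fixing a given function\<close>

text \<open>A function with Bernstein coefficients \<open>g\<close> is fixed iff it takes the value \<open>g k\<close> at the
  \<open>k\<close>-th node.\<close>

lemma gen_bernstein_operator_fixes_iff:
  assumes "a < b" and B: "gen_bernstein_operator n a b t (\<lambda>_. 1) B"
    and cont: "continuous_on {a..b} f"
    and f: "\<forall>x\<in>{a..b}. f x = (\<Sum>k\<le>n. g k * bernstein_basis n a b k x)"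
  shows "op_fixes a b B f \<longleftrightarrow> (\<forall>k\<le>n. f (t k) = g k)"
proof -
  have Bf: "B f x = (\<Sum>k\<le>n. f (t k) * bernstein_basis n a b k x)" if "x \<in> {a..b}" for x
    using B cont that by (simp add: gen_bernstein_operator_def)
  show ?thesis
  proof
    assume "op_fixes a b B f"
    then have eq: "(\<Sum>k\<le>n. f (t k) * bernstein_basis n a b k x) = (\<Sum>k\<le>n. g k * bernstein_basis n a b k x)"
      if "x \<in> {a..b}" for x
      using that Bf f by (simp add: op_fixes_def)
    have "f (t k) = g k" if "k \<le> n" for k
      by (rule bernstein_sum_eq_imp_coeff_eq[OF assms(1) _ that, where c = "\<lambda>k. f (t k)" and d = g])
        (rule eq)
    then show "\<forall>k\<le>n. f (t k) = g k" by blast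
  next
    assume "\<forall>k\<le>n. f (t k) = g k"
    then show "op_fixes a b B f" using Bf f by (simp add: op_fixes_def)
  qed
qed

text \<open>Hence the search for an operator reduces to a search for nodes.\<close>

lemma ex_gen_bernstein_operator_fixing_iff:
  assumes "a < b" and cont: "continuous_on {a..b} f"
    and f: "\<forall>x\<in>{a..b}. f x = (\<Sum>k\<le>n. g k * bernstein_basis n a b k x)"
  shows "(\<exists>B. gen_bernstein_operator n a b t (\<lambda>_. 1) B \<and> op_fixes a b B (\<lambda>_. 1) \<and> op_fixes a b B f)
    \<longleftrightarrow> (\<forall>k\<le>n. t k \<in> {a..b} \<and> f (t k) = g k)"
proof
  assume "\<exists>B. gen_bernstein_operator n a b t (\<lambda>_. 1) B \<and> op_fixes a b B (\<lambda>_. 1) \<and> op_fixes a b B f"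
  then obtain B where B: "gen_bernstein_operator n a b t (\<lambda>_. 1) B" "op_fixes a b B f" by blast
  then show "\<forall>k\<le>n. t k \<in> {a..b} \<and> f (t k) = g k"
    using gen_bernstein_operator_fixes_iff[OF assms(1) B(1) cont f]
    by (simp add: gen_bernstein_operator_def)
next
  assume t: "\<forall>k\<le>n. t k \<in> {a..b} \<and> f (t k) = g k"
  define B where "B h = (\<lambda>x. \<Sum>k\<le>n. h (t k) * bernstein_basis n a b k x)" for h :: "real \<Rightarrow> real"
  have B: "gen_bernstein_operator n a b t (\<lambda>_. 1) B"
    using t by (simp add: gen_bernstein_operator_def B_def bernstein_sum_in_poly_space)
  moreover have "op_fixes a b B (\<lambda>_. 1)"
    by (simp add: op_fixes_def B_def bernstein_basis_partition_of_unity assms(1))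
  moreover have "op_fixes a b B f"
    using gen_bernstein_operator_fixes_iff[OF assms(1) B cont f] t by simp
  ultimately show "\<exists>B. gen_bernstein_operator n a b t (\<lambda>_. 1) B
      \<and> op_fixes a b B (\<lambda>_. 1) \<and> op_fixes a b B f" by blast
qed

lemma ex_nodes_if_coeffs_mono:
  assumes "a < b" and cont: "continuous_on {a..b} f"
    and f: "\<forall>x\<in>{a..b}. f x = (\<Sum>k\<le>n. g k * bernstein_basis n a b k x)"
    and g: "mono_on {..n} g"
  shows "\<exists>t. \<forall>k\<le>n. t k \<in> {a..b} \<and> f (t k) = g k"
proof -
  have "f a = g 0" "f b = g n"
    using f assms(1) by (simp_all add: bernstein_sum_left bernstein_sum_right)
  moreover have "g 0 \<le> g k" "g k \<le> g n" if "k \<le> n" for k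
    using g that by (auto simp: mono_on_def)
  ultimately have "\<exists>x\<in>{a..b}. f x = g k" if "k \<le> n" for k
    using IVT'[of f a "g k" b] cont assms(1) that by (simp add: Bex_def)
  then show ?thesis by metis
qed

section \<open>Equivalence of the three conditions\<close>

theorem theorem3p2:
  fixes n :: nat and a b :: real and f1 :: "real \<Rightarrow> real" and \<gamma> w :: "nat \<Rightarrow> real"
  assumes "n \<ge> 1" and "a < b"
    and "f1 \<in> poly_space n a b"
    and "strict_mono_on {a..b} f1"
    and "\<forall>x\<in>{a..b}. f1 x = (\<Sum>k\<le>n. \<gamma> k * bernstein_basis n a b k x)"
    and "\<forall>x\<in>{a..b}. (f1 has_real_derivative
           (\<Sum>k\<le>n - 1. w k * bernstein_basis (n - 1) a b k x)) (at x within {a..b})"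
  shows
    "((\<exists>B t. gen_bernstein_operator n a b t (\<lambda>_. 1) B
          \<and> op_fixes a b B (\<lambda>_. 1) \<and> op_fixes a b B f1
          \<and> t 0 = a \<and> t n = b \<and> mono_on {..n} t)
        \<longleftrightarrow> mono_on {..n} \<gamma>)
     \<and> (mono_on {..n} \<gamma> \<longleftrightarrow> (\<forall>k\<le>n - 1. w k \<ge> 0))
     \<and> ((\<exists>B t. gen_bernstein_operator n a b t (\<lambda>_. 1) B
          \<and> op_fixes a b B (\<lambda>_. 1) \<and> op_fixes a b B f1
          \<and> t 0 = a \<and> t n = b \<and> strict_mono_on {..n} t)
        \<longleftrightarrow> strict_mono_on {..n} \<gamma>)
     \<and> (strict_mono_on {..n} \<gamma> \<longleftrightarrow> (\<forall>k\<le>n - 1. w k > 0))"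
proof -
  note ab = \<open>a < b\<close> and f1_mono = assms(4) and f1_eq = assms(5) and f1_deriv = assms(6)
  obtain m where n: "n = Suc m" using \<open>n \<ge> 1\<close> by (cases n) auto
  have cont: "continuous_on {a..b} f1"
    using f1_deriv by (intro DERIV_continuous_on) blast

  have w_eq: "w k = real n / (b - a) * (\<gamma> (Suc k) - \<gamma> k)" if "k \<le> m" for k
  proof (rule bernstein_sum_eq_imp_coeff_eq[OF ab _ that])
    fix x assume x: "x \<in> {a..b}"
    have "(f1 has_real_derivative
        (\<Sum>k\<le>m. real (Suc m) / (b - a) * (\<gamma> (Suc k) - \<gamma> k) * bernstein_basis m a b k x))
        (at x within {a..b})"
      by (rule has_field_derivative_transform_within[OF bernstein_sum_has_real_derivative[OF ab] zero_less_one x])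
        (simp add: f1_eq n)
    moreover have "(f1 has_real_derivative (\<Sum>k\<le>m. w k * bernstein_basis m a b k x)) (at x within {a..b})"
      using f1_deriv x n by simp
    ultimately show "(\<Sum>k\<le>m. w k * bernstein_basis m a b k x)
        = (\<Sum>k\<le>m. real n / (b - a) * (\<gamma> (Suc k) - \<gamma> k) * bernstein_basis m a b k x)"
      using vector_derivative_unique_within_closed_interval[of a b x f1] ab x n
      by (simp add: has_real_derivative_iff_has_vector_derivative)
  qed
  have pos: "real n / (b - a) > 0" using n ab by simp
  have w_sign: "w k \<ge> 0 \<longleftrightarrow> \<gamma> k \<le> \<gamma> (Suc k)" "w k > 0 \<longleftrightarrow> \<gamma> k < \<gamma> (Suc k)" if "k \<le> m" for k
    unfolding w_eq[OF that] zero_le_mult_iff zero_less_mult_iff using pos by auto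
  have bc: "mono_on {..n} \<gamma> \<longleftrightarrow> (\<forall>k\<le>n - 1. w k \<ge> 0)"
    "strict_mono_on {..n} \<gamma> \<longleftrightarrow> (\<forall>k\<le>n - 1. w k > 0)"
    by (simp_all add: n mono_on_atMost_Suc_iff strict_mono_on_atMost_Suc_iff w_sign)

  have nodes_iff: "(\<exists>B t. gen_bernstein_operator n a b t (\<lambda>_. 1) B
        \<and> op_fixes a b B (\<lambda>_. 1) \<and> op_fixes a b B f1 \<and> t 0 = a \<and> t n = b \<and> Q t)
      \<longleftrightarrow> (\<exists>t. (\<forall>k\<le>n. t k \<in> {a..b} \<and> f1 (t k) = \<gamma> k) \<and> Q t)" for Q
  proof -
    \<comment> \<open>The end nodes are forced, as \<open>f1\<close> is injective and takes the values \<open>\<gamma> 0\<close> and \<open>\<gamma> n\<close> at \<open>a\<close> and \<open>b\<close>.\<close>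
    have ends: "t 0 = a" "t n = b" if t: "\<forall>k\<le>n. t k \<in> {a..b} \<and> f1 (t k) = \<gamma> k" for t
    proof -
      have "f1 a = \<gamma> 0" "f1 b = \<gamma> n"
        using f1_eq ab by (simp_all add: bernstein_sum_left bernstein_sum_right)
      then show "t 0 = a" "t n = b"
        using t ab inj_onD[OF strict_mono_on_imp_inj_on[OF f1_mono], of "t 0" a]
          inj_onD[OF strict_mono_on_imp_inj_on[OF f1_mono], of "t n" b]
        by auto
    qed
    have "(\<exists>B. gen_bernstein_operator n a b t (\<lambda>_. 1) B
        \<and> op_fixes a b B (\<lambda>_. 1) \<and> op_fixes a b B f1 \<and> t 0 = a \<and> t n = b \<and> Q t)
      \<longleftrightarrow> (\<forall>k\<le>n. t k \<in> {a..b} \<and> f1 (t k) = \<gamma> k) \<and> Q t" for t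
      unfolding ex_gen_bernstein_operator_fixing_iff[OF ab cont f1_eq, symmetric]
      using ends[of t, unfolded ex_gen_bernstein_operator_fixing_iff[OF ab cont f1_eq, symmetric]]
      by blast
    then show ?thesis by (subst ex_comm) (simp only:)
  qed
  have transfer: "mono_on {..n} t \<longleftrightarrow> mono_on {..n} \<gamma>" "strict_mono_on {..n} t \<longleftrightarrow> strict_mono_on {..n} \<gamma>"
    if "\<forall>k\<le>n. t k \<in> {a..b} \<and> f1 (t k) = \<gamma> k" for t
    using strict_mono_on_preimage_mono_iff[OF f1_mono, of n t \<gamma>] that by auto
  have ex: "\<exists>t. \<forall>k\<le>n. t k \<in> {a..b} \<and> f1 (t k) = \<gamma> k" if "mono_on {..n} \<gamma>"
    by (rule ex_nodes_if_coeffs_mono[OF ab cont f1_eq that])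
  have "strict_mono_on {..n} \<gamma> \<Longrightarrow> mono_on {..n} \<gamma>"
    by (rule strict_mono_on_imp_mono_on)
  then show ?thesis
    unfolding nodes_iff using bc transfer ex by blast
qed

end
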